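(* Let $(\Omega,\Omega^\Omega,\mathcal B_\Omega,\mathsf P)$ be a sample space with product-compatible probability measures that satisfies the Fubini property. Then for all quasi-measurable spaces $(\mathcal X,\mathcal X^\Omega)$ and $(\mathcal Y,\mathcal Y^\Omega)$, every $P(X)\in\mathsf P(\mathcal X)$, every $Q(Y)\in\mathsf P(\mathcal Y)$ and every quasi-measurable map $h:\mathcal X\times\mathcal Y\to[0,\infty]$ one has $$\iint h(x,y)\,P(X\in dx)\,Q(Y\in dy)=\iint h(x,y)\,Q(Y\in dy)\,P(X\in dx).$$
   Context: Sample space: $\Omega$ is a non-empty set; $\Omega^\Omega$ is a set of maps $\Omega\to\Omega$ containing the identity and all constant maps and closed under composition; $\mathcal B_\Omega$ is a $\sigma$-algebra on $\Omega$ such that every $\Phi\in\Omega^\Omega$ is $\mathcal B_\Omega$-$\mathcal B_\Omega$-measurable. A quasi-measurable space is a pair $(\mathcal X,\mathcal X^\Omega)$ of a set and a set $\mathcal X^\Omega$ of maps $\Omega\to\mathcal X$ containing all constant maps and closed under $X\mapsto X\circ\Phi$, $\Phi\in\Omega^\Omega$. A map $g:\mathcal X\to\mathcal Y$ is quasi-measurable if $g\circ X\in\mathcal Y^\Omega$ for all $X\in\mathcal X^\Omega$. The product is $(\mathcal X\times\mathcal Y,\mathcal X^\Omega\times\mathcal Y^\Omega)$. The induced $\sigma$-algebra of $(\mathcal X,\mathcal X^\Omega)$ is $\mathcal B_{\mathcal X}=\{A\subseteq\mathcal X\mid X^{-1}(A)\in\mathcal B_\Omega\ \forall X\in\mathcal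 X^\Omega\}$; $\mathcal B_{\mathcal X\times\mathcal Y}$ denotes the induced $\sigma$-algebra of the product quasi-measurable space. The interval $[0,\infty]$ carries as admissible random variables all $\mathcal B_\Omega$-Borel-measurable maps $\Omega\to[0,\infty]$. For $D\subseteq\mathcal X\times\mathcal Y$ write $D_x=\{y\mid(x,y)\in D\}$ and $D^y=\{x\mid(x,y)\in D\}$. Product-compatible probability measures: $\mathsf P$ is a non-empty set of probability measures $P:\mathcal B_P\to[0,1]$ on $\Omega$, each with its own $\sigma$-algebra $\mathcal B_P$ on $\Omega$ as domain, such that: (i) for all $\Phi\in\Omega^\Omega$, $P\in\mathsf P$, $D\in\mathcal B_\Omega$: $\Phi^{-1}(D)\in\mathcal B_P$; (ii) for all $D\in\mathcal B_{\Omega\times\Omega}$ and $P\in\mathsf P$ the map $\omega\mapsto P(D^\omega)$ is $\mathcal B_\Omega$-measurable; (iii) for all $P_1,P_2\in\mathsf P$ there are $P\in\mathsf P$ and $\Phi=(\Phi_1,\Phi_2)$ with $\Phi_1,\Phi_2\in\Omega^\Omega$ such that for all $D\in\mathcal B_{\Omega\times\Omega}$: $\int P_1(D^{\omega_2})\,P_2(d\omega_2)=P(\Phi^{-1}(D))$. Fubini property: for all $P_1,P_2\in\mathsf P$ and $D\in\mathcal B_{\Omega\times\Omega}$: $\int P_2(D_{\omega_1})\,P_1(d\omega_1)=\int P_1(D^{\omega_2})\,P_2(d\omega_2)$. $\mathsf P(\mathcal X)$ is the set of push-forward measures $P(X):\mathcal B_{\mathcal X}\to[0,1]$, $P(X\in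 A):=P(X^{-1}(A))$, with $P\in\mathsf P$, $X\in\mathcal X^\Omega$. *)

theory Defs
  imports "HOL-Probability.Probability"
begin

text \<open>
  The measurable space \<open>(\<Omega>, \<B>\<^sub>\<Omega>)\<close> is a value \<open>M\<close> of type \<open>'w measure\<close> of which only
  \<^term>\<open>space M\<close> and \<^term>\<open>sets M\<close> are used; no condition is put on its measure part, which
  plays no role.  Maps defined on a carrier \<open>S\<close> are represented by functions that are
  \<^const>\<open>undefined\<close> outside \<open>S\<close>, so that equality of maps is equality of functions;
  \<^const>\<open>compose\<close> is composition of such maps.
\<close>

locale sample_space =
  fixes M :: "'w measure" and F :: "('w \<Rightarrow> 'w) set"
  assumes nonempty: "space M \<noteq> {}"
    and maps: "F \<subseteq> space M \<rightarrow>\<^sub>E space M"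
    and ident: "(\<lambda>\<omega>\<in>space M. \<omega>) \<in> F"
    and const: "\<And>c. c \<in> space M \<Longrightarrow> (\<lambda>\<omega>\<in>space M. c) \<in> F"
    and comp: "\<And>\<Phi> \<Psi>. \<Phi> \<in> F \<Longrightarrow> \<Psi> \<in> F \<Longrightarrow> compose (space M) \<Phi> \<Psi> \<in> F"
    and measurable: "\<And>\<Phi>. \<Phi> \<in> F \<Longrightarrow> \<Phi> \<in> measurable M M"

text \<open>A set together with its admissible random variables.\<close>

type_synonym ('w, 'x) qspace = "'x set \<times> ('w \<Rightarrow> 'x) set"

abbreviation qcarrier :: "('w, 'x) qspace \<Rightarrow> 'x set" where
  "qcarrier \<equiv> fst"

abbreviation qvars :: "('w, 'x) qspace \<Rightarrow> ('w \<Rightarrow> 'x) set" where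
  "qvars \<equiv> snd"

definition quasi_measurable_space ::
  "'w measure \<Rightarrow> ('w \<Rightarrow> 'w) set \<Rightarrow> ('w, 'x) qspace \<Rightarrow> bool" where
  "quasi_measurable_space M F \<X> \<longleftrightarrow>
     qvars \<X> \<subseteq> space M \<rightarrow>\<^sub>E qcarrier \<X> \<and>
     (\<forall>c\<in>qcarrier \<X>. (\<lambda>\<omega>\<in>space M. c) \<in> qvars \<X>) \<and>
     (\<forall>X\<in>qvars \<X>. \<forall>\<Phi>\<in>F. compose (space M) X \<Phi> \<in> qvars \<X>)"

text \<open>The values of \<open>g\<close> outside the carrier of \<open>\<X>\<close> are irrelevant.\<close>

definition quasi_measurable_map ::
  "'w measure \<Rightarrow> ('w, 'x) qspace \<Rightarrow> ('w, 'y) qspace \<Rightarrow> ('x \<Rightarrow> 'y) \<Rightarrow> bool" where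
  "quasi_measurable_map M \<X> \<Y> g \<longleftrightarrow>
     g \<in> qcarrier \<X> \<rightarrow> qcarrier \<Y> \<and>
     (\<forall>X\<in>qvars \<X>. compose (space M) g X \<in> qvars \<Y>)"

definition qprod ::
  "'w measure \<Rightarrow> ('w, 'x) qspace \<Rightarrow> ('w, 'y) qspace \<Rightarrow> ('w, 'x \<times> 'y) qspace" where
  "qprod M \<X> \<Y> =
     (qcarrier \<X> \<times> qcarrier \<Y>,
      {\<lambda>\<omega>\<in>space M. (X \<omega>, Y \<omega>) | X Y. X \<in> qvars \<X> \<and> Y \<in> qvars \<Y>})"

definition qennreal :: "'w measure \<Rightarrow> ('w, ennreal) qspace" where
  "qennreal M = (UNIV, extensional (space M) \<inter> borel_measurable M)"

text \<open>
  The induced \<open>\<sigma>\<close>-algebra, packaged as a measurable space.  The collection passed to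
  \<^const>\<open>sigma\<close> is already a \<open>\<sigma>\<close>-algebra, so nothing is added to it;
  see \<open>sets_induced\<close> below.
\<close>

definition induced :: "'w measure \<Rightarrow> ('w, 'x) qspace \<Rightarrow> 'x measure" where
  "induced M \<X> =
     sigma (qcarrier \<X>)
       {A. A \<subseteq> qcarrier \<X> \<and> (\<forall>X\<in>qvars \<X>. X -` A \<inter> space M \<in> sets M)}"

lemma space_induced: "space (induced M \<X>) = qcarrier \<X>"
  unfolding induced_def by (rule space_measure_of) auto

lemma sets_induced:
  assumes "qvars \<X> \<subseteq> space M \<rightarrow> qcarrier \<X>"
  shows "sets (induced M \<X>) =
    {A. A \<subseteq> qcarrier \<X> \<and> (\<forall>X\<in>qvars \<X>. X -` A \<inter> space M \<in> sets M)}"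
    (is "_ = ?S")
proof -
  have "sigma_algebra (qcarrier \<X>) ?S"
    unfolding sigma_algebra_iff2
  proof (intro conjI ballI allI impI)
    show "?S \<subseteq> Pow (qcarrier \<X>)" by auto
    show "{} \<in> ?S" by auto
  next
    fix A assume A: "A \<in> ?S"
    have "X -` (qcarrier \<X> - A) \<inter> space M \<in> sets M" if X: "X \<in> qvars \<X>" for X
    proof -
      have "X -` (qcarrier \<X> - A) \<inter> space M = space M - (X -` A \<inter> space M)"
        using assms X by auto
      then show ?thesis using A X by auto
    qed
    then show "qcarrier \<X> - A \<in> ?S" by auto
  next
    fix A :: "nat \<Rightarrow> _" assume A: "range A \<subseteq> ?S"
    have "X -` (\<Union>i. A i) \<inter> space M \<in> sets M" if X: "X \<in> qvars \<X>" for X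
    proof -
      have "X -` (\<Union>i. A i) \<inter> space M = (\<Union>i. X -` A i \<inter> space M)" by auto
      moreover have "range (\<lambda>i. X -` A i \<inter> space M) \<subseteq> sets M" using A X by auto
      ultimately show ?thesis by (simp only: sets.countable_UN)
    qed
    then show "(\<Union>i. A i) \<in> ?S" using A by auto
  qed
  then show ?thesis
    unfolding induced_def by (rule sigma_algebra.sets_measure_of_eq)
qed

abbreviation induced_square :: "'w measure \<Rightarrow> ('w \<Rightarrow> 'w) set \<Rightarrow> ('w \<times> 'w) measure" where
  "induced_square M F \<equiv> induced M (qprod M (space M, F) (space M, F))"

text \<open>Each \<open>P \<in> \<P>\<close> carries its own \<open>\<sigma>\<close>-algebra \<^term>\<open>sets P\<close> on \<^term>\<open>space M\<close>.\<close>

locale product_compatible = sample_space M F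
  for M :: "'w measure" and F :: "('w \<Rightarrow> 'w) set" +
  fixes \<P> :: "'w measure set"
  assumes probs_nonempty: "\<P> \<noteq> {}"
    and probs: "\<And>P. P \<in> \<P> \<Longrightarrow> prob_space P"
    and space_probs: "\<And>P. P \<in> \<P> \<Longrightarrow> space P = space M"
    and vimage_in_domain:
      "\<And>\<Phi> P D. \<Phi> \<in> F \<Longrightarrow> P \<in> \<P> \<Longrightarrow> D \<in> sets M \<Longrightarrow> \<Phi> -` D \<inter> space M \<in> sets P"
    and section_measurable:
      "\<And>D P. D \<in> sets (induced_square M F) \<Longrightarrow> P \<in> \<P> \<Longrightarrow>
         (\<lambda>\<omega>. emeasure P {\<omega>'. (\<omega>', \<omega>) \<in> D}) \<in> borel_measurable M"
    and product_representable:
      "\<And>P\<^sub>1 P\<^sub>2. P\<^sub>1 \<in> \<P> \<Longrightarrow> P\<^sub>2 \<in> \<P> \<Longrightarrow>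
         \<exists>P\<in>\<P>. \<exists>\<Phi>\<^sub>1\<in>F. \<exists>\<Phi>\<^sub>2\<in>F. \<forall>D\<in>sets (induced_square M F).
           (\<integral>\<^sup>+ \<omega>\<^sub>2. emeasure P\<^sub>1 {\<omega>\<^sub>1. (\<omega>\<^sub>1, \<omega>\<^sub>2) \<in> D} \<partial>P\<^sub>2)
           = emeasure P ((\<lambda>\<omega>. (\<Phi>\<^sub>1 \<omega>, \<Phi>\<^sub>2 \<omega>)) -` D \<inter> space M)"

definition fubini_property ::
  "'w measure \<Rightarrow> ('w \<Rightarrow> 'w) set \<Rightarrow> 'w measure set \<Rightarrow> bool" where
  "fubini_property M F \<P> \<longleftrightarrow>
     (\<forall>P\<^sub>1\<in>\<P>. \<forall>P\<^sub>2\<in>\<P>. \<forall>D\<in>sets (induced_square M F).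
        (\<integral>\<^sup>+ \<omega>\<^sub>1. emeasure P\<^sub>2 {\<omega>\<^sub>2. (\<omega>\<^sub>1, \<omega>\<^sub>2) \<in> D} \<partial>P\<^sub>1)
        = (\<integral>\<^sup>+ \<omega>\<^sub>2. emeasure P\<^sub>1 {\<omega>\<^sub>1. (\<omega>\<^sub>1, \<omega>\<^sub>2) \<in> D} \<partial>P\<^sub>2))"

definition pushforwards ::
  "'w measure \<Rightarrow> 'w measure set \<Rightarrow> ('w, 'x) qspace \<Rightarrow> 'x measure set" where
  "pushforwards M \<P> \<X> = {distr P (induced M \<X>) X | P X. P \<in> \<P> \<and> X \<in> qvars \<X>}"

end

theory Submission
  imports Defs
begin

text \<open>
  A map on an induced space is measurable iff its composition with every admissible random
  variable is.  Hence \<open>h\<close> pulls back along \<open>X \<times> Y\<close> to a function on \<open>\<Omega> \<times> \<Omega>\<close> measurable for the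
  induced \<open>\<sigma>\<close>-algebra, and both iterated integrals become iterated integrals of this pullback.
  There the assumptions on sections and the Fubini property for sets extend from indicators to
  nonnegative functions by monotone convergence.
\<close>

section \<open>Measurable maps on induced spaces and their products\<close>

text \<open>The preimage of \<open>A\<close> under \<open>f\<close> after \<open>X\<close> is the
  preimage under \<open>X\<close> of the part of the carrier that \<open>f\<close> sends into
  \<open>A\<close>. Membership in the induced sigma-algebra is tested by exactly these
  preimages.\<close>

lemma measurable_induced_iff:
  assumes "qvars \<X> \<subseteq> space M \<rightarrow> qcarrier \<X>"
  shows "f \<in> measurable (induced M \<X>) N \<longleftrightarrow>
    f \<in> qcarrier \<X> \<rightarrow> space N \<and> (\<forall>X\<in>qvars \<X>. (\<lambda>\<omega>. f (X \<omega>)) \<in> measurable M N)"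
    (is "?L \<longleftrightarrow> ?R")
proof -
  have vimage: "(\<lambda>\<omega>. f (X \<omega>)) -` A \<inter> space M = X -` (f -` A \<inter> qcarrier \<X>) \<inter> space M"
    if "X \<in> qvars \<X>" for X A
    using assms that by auto
  show ?thesis
  proof
    assume L: ?L
    then have "f \<in> qcarrier \<X> \<rightarrow> space N"
      using measurable_space[OF L] by (auto simp: space_induced)
    moreover have "(\<lambda>\<omega>. f (X \<omega>)) \<in> measurable M N" if X: "X \<in> qvars \<X>" for X
    proof (rule measurableI)
      show "f (X \<omega>) \<in> space N" if "\<omega> \<in> space M" for \<omega>
        using measurable_space[OF L] assms X that by (auto simp: space_induced)
      show "(\<lambda>\<omega>. f (X \<omega>)) -` A \<inter> space M \<in> sets M" if "A \<in> sets N" for A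
        using measurable_sets[OF L that] X
        by (simp add: vimage sets_induced[OF assms] space_induced)
    qed
    ultimately show ?R by blast
  next
    assume R: ?R
    show ?L
    proof (rule measurableI)
      show "f x \<in> space N" if "x \<in> space (induced M \<X>)" for x
        using R that by (auto simp: space_induced)
      fix A assume A: "A \<in> sets N"
      have "X -` (f -` A \<inter> qcarrier \<X>) \<inter> space M \<in> sets M" if X: "X \<in> qvars \<X>" for X
        using R X measurable_sets[OF _ A] vimage[OF X] by metis
      then show "f -` A \<inter> space (induced M \<X>) \<in> sets (induced M \<X>)"
        by (simp add: sets_induced[OF assms] space_induced)
    qed
  qed
qed

lemma qvars_measurable:
  assumes "qvars \<X> \<subseteq> space M \<rightarrow> qcarrier \<X>" "X \<in> qvars \<X>"
  shows "X \<in> measurable M (induced M \<X>)"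
  \<comment> \<open>The identity of the induced space is measurable; the criterion read from left to
    right composes it with \<open>X\<close>.\<close>
  using measurable_induced_iff[OF assms(1), of "\<lambda>x. x" "induced M \<X>"] assms(2) by simp

lemma qvars_qprod:
  assumes "qvars \<X> \<subseteq> space M \<rightarrow> qcarrier \<X>" "qvars \<Y> \<subseteq> space M \<rightarrow> qcarrier \<Y>"
  shows "qvars (qprod M \<X> \<Y>) \<subseteq> space M \<rightarrow> qcarrier (qprod M \<X> \<Y>)"
  using assms by (fastforce simp: qprod_def)

text \<open>Admissible variables of a product are pairs set to \<open>undefined\<close> outside
  \<open>space M\<close>. Measurability depends only on values on \<open>space M\<close>, so the
  test can be phrased with plain pairs.\<close>

lemma measurable_induced_qprod_iff:
  assumes "qvars \<X> \<subseteq> space M \<rightarrow> qcarrier \<X>" "qvars \<Y> \<subseteq> space M \<rightarrow> qcarrier \<Y>"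
  shows "f \<in> measurable (induced M (qprod M \<X> \<Y>)) N \<longleftrightarrow>
    f \<in> qcarrier \<X> \<times> qcarrier \<Y> \<rightarrow> space N \<and>
    (\<forall>X\<in>qvars \<X>. \<forall>Y\<in>qvars \<Y>. (\<lambda>\<omega>. f (X \<omega>, Y \<omega>)) \<in> measurable M N)"
proof -
  have restrict: "(\<lambda>\<omega>. f ((\<lambda>\<omega>\<in>space M. (X \<omega>, Y \<omega>)) \<omega>)) \<in> measurable M N \<longleftrightarrow>
      (\<lambda>\<omega>. f (X \<omega>, Y \<omega>)) \<in> measurable M N" for X Y
    by (rule measurable_cong) simp
  have "(\<forall>Z\<in>qvars (qprod M \<X> \<Y>). (\<lambda>\<omega>. f (Z \<omega>)) \<in> measurable M N) \<longleftrightarrow>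
      (\<forall>X\<in>qvars \<X>. \<forall>Y\<in>qvars \<Y>.
        (\<lambda>\<omega>. f ((\<lambda>\<omega>\<in>space M. (X \<omega>, Y \<omega>)) \<omega>)) \<in> measurable M N)"
    by (auto simp only: qprod_def snd_conv mem_Collect_eq)
  then show ?thesis
    unfolding measurable_induced_iff[OF qvars_qprod[OF assms]] restrict
    by (simp add: qprod_def)
qed

text \<open>The criterion for products is symmetric in the two factors: exchanging the arguments
  only permutes the quantifiers over \<open>X\<close> and \<open>Y\<close>.\<close>

lemma measurable_induced_swap:
  assumes "qvars \<X> \<subseteq> space M \<rightarrow> qcarrier \<X>" "qvars \<Y> \<subseteq> space M \<rightarrow> qcarrier \<Y>"
    and "f \<in> measurable (induced M (qprod M \<X> \<Y>)) N"
  shows "(\<lambda>(y, x). f (x, y)) \<in> measurable (induced M (qprod M \<Y> \<X>)) N"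
  using assms(3)
  unfolding measurable_induced_qprod_iff[OF assms(1,2)] measurable_induced_qprod_iff[OF assms(2,1)]
  by (simp add: Pi_iff)

text \<open>Since the admissible variables of the target are the Borel maps, quasi-measurability is
  the criterion for induced spaces up to values outside \<open>space M\<close>.\<close>

lemma quasi_measurable_map_borel:
  assumes "qvars \<X> \<subseteq> space M \<rightarrow> qcarrier \<X>" "quasi_measurable_map M \<X> (qennreal M) h"
  shows "h \<in> borel_measurable (induced M \<X>)"
proof -
  have "(\<lambda>\<omega>. h (X \<omega>)) \<in> borel_measurable M" if "X \<in> qvars \<X>" for X
  proof -
    have "compose (space M) h X \<in> borel_measurable M"
      using assms(2) that by (auto simp: quasi_measurable_map_def qennreal_def)
    then show ?thesis
      by (rule measurable_cong[THEN iffD1, rotated]) (simp add: compose_def)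
  qed
  then show ?thesis
    by (simp add: measurable_induced_iff[OF assms(1)])
qed

section \<open>Sections and partial integrals on the square of the sample space\<close>

context product_compatible
begin

lemma F_subset: "qvars (space M, F) \<subseteq> space M \<rightarrow> qcarrier (space M, F)"
  using maps by auto

text \<open>Condition \<open>vimage_in_domain\<close> at the identity map gives
  \<open>sets M \<subseteq> sets P\<close>. Measurability can thus be shown once for
  \<open>M\<close> and then used for every measure in \<open>\<P>\<close>.\<close>

lemma measurable_probs:
  assumes "P \<in> \<P>" "f \<in> measurable M N"
  shows "f \<in> measurable P N"
proof -
  have "sets M \<subseteq> sets P"
  proof
    fix A assume A: "A \<in> sets M"
    have "(\<lambda>\<omega>\<in>space M. \<omega>) -` A \<inter> space M = A"
      using sets.sets_into_space[OF A] by auto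
    then show "A \<in> sets P" using vimage_in_domain[OF ident assms(1) A] by simp
  qed
  then show ?thesis
    using assms(2) measurable_mono[OF order_refl refl, of M P N] space_probs[OF assms(1)] by auto
qed

text \<open>A section is \<open>g\<close> along the pair of the identity and a constant map, both of
  which lie in \<open>F\<close>.\<close>

lemma measurable_section_fst:
  assumes "g \<in> measurable (induced_square M F) N" "\<omega>\<^sub>2 \<in> space M"
  shows "(\<lambda>\<omega>\<^sub>1. g (\<omega>\<^sub>1, \<omega>\<^sub>2)) \<in> measurable M N"
proof -
  have "(\<lambda>\<omega>. g ((\<lambda>\<omega>\<in>space M. \<omega>) \<omega>, (\<lambda>\<omega>\<in>space M. \<omega>\<^sub>2) \<omega>)) \<in> measurable M N"
    using assms(1) ident const[OF assms(2)]
    unfolding measurable_induced_qprod_iff[OF F_subset F_subset] snd_conv by blast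
  then show ?thesis
    by (rule measurable_cong[THEN iffD1, rotated]) simp
qed

lemma space_square: "space (induced_square M F) = space M \<times> space M"
  by (simp add: space_induced qprod_def)

lemma borel_section_fst:
  assumes "P \<in> \<P>" "g \<in> borel_measurable (induced_square M F)" "\<omega>\<^sub>2 \<in> space M"
  shows "(\<lambda>\<omega>\<^sub>1. g (\<omega>\<^sub>1, \<omega>\<^sub>2)) \<in> borel_measurable P"
  using measurable_probs[OF assms(1) measurable_section_fst[OF assms(2,3)]] .

lemma nn_integral_indicator_section:
  assumes "P \<in> \<P>" "A \<in> sets (induced_square M F)" "\<omega>\<^sub>2 \<in> space M"
  shows "(\<integral>\<^sup>+ \<omega>\<^sub>1. indicator A (\<omega>\<^sub>1, \<omega>\<^sub>2) \<partial>P) = emeasure P {\<omega>\<^sub>1. (\<omega>\<^sub>1, \<omega>\<^sub>2) \<in> A}"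
proof -
  let ?S = "{\<omega>\<^sub>1. (\<omega>\<^sub>1, \<omega>\<^sub>2) \<in> A}"
  have indicator_eq: "(\<lambda>\<omega>\<^sub>1. indicator A (\<omega>\<^sub>1, \<omega>\<^sub>2) :: ennreal) = indicator ?S"
    by (auto simp: fun_eq_iff indicator_def)
  \<comment> \<open>The integral of the indicator is the measure of \<open>?S\<close> once
    \<open>?S\<close> lies in \<open>sets P\<close>. This membership is read off from the
    measurability of the indicator as a section.\<close>
  have "(indicator ?S :: _ \<Rightarrow> ennreal) \<in> borel_measurable P"
    unfolding indicator_eq[symmetric]
    by (rule borel_section_fst[OF assms(1) borel_measurable_indicator[OF assms(2)] assms(3)])
  moreover have "?S \<subseteq> space P"
    using sets.sets_into_space[OF assms(2)] by (auto simp: space_square space_probs[OF assms(1)])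
  ultimately have "?S \<in> sets P"
    by (simp add: borel_measurable_indicator_iff Int_absorb2)
  then show ?thesis
    by (simp add: indicator_eq)
qed

lemma nn_integral_SUP_section:
  assumes "P \<in> \<P>" "\<And>i. U i \<in> borel_measurable (induced_square M F)" "incseq U" "\<omega>\<^sub>2 \<in> space M"
  shows "(\<integral>\<^sup>+ \<omega>\<^sub>1. (SUP i. U i) (\<omega>\<^sub>1, \<omega>\<^sub>2) \<partial>P) = (SUP i. \<integral>\<^sup>+ \<omega>\<^sub>1. U i (\<omega>\<^sub>1, \<omega>\<^sub>2) \<partial>P)"
proof -
  have "incseq (\<lambda>i \<omega>\<^sub>1. U i (\<omega>\<^sub>1, \<omega>\<^sub>2))"
    using assms(3) by (auto simp: mono_def le_fun_def)
  then show ?thesis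
    unfolding SUP_apply
    by (rule nn_integral_monotone_convergence_SUP) (rule borel_section_fst[OF assms(1,2,4)])
qed

text \<open>The induced sigma-algebra contains the product sigma-algebra and can be strictly larger,
  so the indicator case comes from \<open>section_measurable\<close> instead of Tonelli's theorem.
  The result is stated for \<open>M\<close>, not for a single measure, because partial integrals are
  later tested along all admissible variables.\<close>

lemma nn_integral_fst_measurable:
  assumes P: "P \<in> \<P>" and "g \<in> borel_measurable (induced_square M F)"
  shows "(\<lambda>\<omega>\<^sub>2. \<integral>\<^sup>+ \<omega>\<^sub>1. g (\<omega>\<^sub>1, \<omega>\<^sub>2) \<partial>P) \<in> borel_measurable M"
  using assms(2)
proof (induction g rule: borel_measurable_induct)
  case (cong f g)
  have "(\<integral>\<^sup>+ \<omega>\<^sub>1. f (\<omega>\<^sub>1, \<omega>\<^sub>2) \<partial>P) = (\<integral>\<^sup>+ \<omega>\<^sub>1. g (\<omega>\<^sub>1, \<omega>\<^sub>2) \<partial>P)" if "\<omega>\<^sub>2 \<in> space M" for \<omega>\<^sub>2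
    using cong.hyps(3) that by (intro nn_integral_cong) (simp add: space_square space_probs[OF P])
  then show ?case
    by (rule measurable_cong[THEN iffD2, OF _ cong.IH])
next
  case (set A)
  show ?case
    by (rule measurable_cong[THEN iffD2, OF nn_integral_indicator_section[OF P set]
          section_measurable[OF set P]])
next
  case (mult u c)
  have "(\<integral>\<^sup>+ \<omega>\<^sub>1. c * u (\<omega>\<^sub>1, \<omega>\<^sub>2) \<partial>P) = c * (\<integral>\<^sup>+ \<omega>\<^sub>1. u (\<omega>\<^sub>1, \<omega>\<^sub>2) \<partial>P)" if "\<omega>\<^sub>2 \<in> space M" for \<omega>\<^sub>2
    by (rule nn_integral_cmult) (rule borel_section_fst[OF P mult.hyps(2) that])
  then show ?case
    by (rule measurable_cong[THEN iffD2]) (use mult.IH in measurable)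
next
  case (add u v)
  have "(\<integral>\<^sup>+ \<omega>\<^sub>1. v (\<omega>\<^sub>1, \<omega>\<^sub>2) + u (\<omega>\<^sub>1, \<omega>\<^sub>2) \<partial>P) =
      (\<integral>\<^sup>+ \<omega>\<^sub>1. v (\<omega>\<^sub>1, \<omega>\<^sub>2) \<partial>P) + (\<integral>\<^sup>+ \<omega>\<^sub>1. u (\<omega>\<^sub>1, \<omega>\<^sub>2) \<partial>P)" if "\<omega>\<^sub>2 \<in> space M" for \<omega>\<^sub>2
    using that by (intro nn_integral_add borel_section_fst[OF P] add.hyps)
  then show ?case
    using borel_measurable_add[OF add.IH(2,1)]
    by (rule measurable_cong[THEN iffD2])
next
  case (seq U)
  have "(\<lambda>\<omega>\<^sub>2. SUP i. \<integral>\<^sup>+ \<omega>\<^sub>1. U i (\<omega>\<^sub>1, \<omega>\<^sub>2) \<partial>P) \<in> borel_measurable M"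
    using seq.IH by (intro borel_measurable_SUP) auto
  then show ?case
    using nn_integral_SUP_section[OF P seq.hyps(1,3)] by (rule measurable_cong[THEN iffD2, rotated])
qed

lemmas measurable_square_swap = measurable_induced_swap[OF F_subset F_subset]

lemma nn_integral_fst_borel:
  assumes "P \<in> \<P>" "Q \<in> \<P>" "g \<in> borel_measurable (induced_square M F)"
  shows "(\<lambda>\<omega>\<^sub>2. \<integral>\<^sup>+ \<omega>\<^sub>1. g (\<omega>\<^sub>1, \<omega>\<^sub>2) \<partial>P) \<in> borel_measurable Q"
  by (rule measurable_probs[OF assms(2) nn_integral_fst_measurable[OF assms(1,3)]])

section \<open>Iterated integrals and their interchange\<close>

text \<open>Changing the order of integration amounts to exchanging the two measures and the
  arguments of \<open>g\<close>. The rules below therefore serve both sides of the Fubini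
  identity.\<close>

definition iterated :: "'w measure \<Rightarrow> 'w measure \<Rightarrow> ('w \<times> 'w \<Rightarrow> ennreal) \<Rightarrow> ennreal" where
  "iterated P Q g = (\<integral>\<^sup>+ \<omega>\<^sub>2. \<integral>\<^sup>+ \<omega>\<^sub>1. g (\<omega>\<^sub>1, \<omega>\<^sub>2) \<partial>P \<partial>Q)"

lemma iterated_cong:
  assumes "P \<in> \<P>" "Q \<in> \<P>" "\<And>z. z \<in> space (induced_square M F) \<Longrightarrow> f z = g z"
  shows "iterated P Q f = iterated P Q g"
  unfolding iterated_def
  using assms(3)
  by (intro nn_integral_cong) (simp add: space_square space_probs[OF assms(1)] space_probs[OF assms(2)])

lemma iterated_indicator:
  assumes "P \<in> \<P>" "Q \<in> \<P>" "A \<in> sets (induced_square M F)"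
  shows "iterated P Q (indicator A) = (\<integral>\<^sup>+ \<omega>\<^sub>2. emeasure P {\<omega>\<^sub>1. (\<omega>\<^sub>1, \<omega>\<^sub>2) \<in> A} \<partial>Q)"
  unfolding iterated_def
  by (rule nn_integral_cong)
    (simp add: nn_integral_indicator_section[OF assms(1,3)] space_probs[OF assms(2)])

lemma iterated_cmult:
  assumes "P \<in> \<P>" "Q \<in> \<P>" "g \<in> borel_measurable (induced_square M F)"
  shows "iterated P Q (\<lambda>z. c * g z) = c * iterated P Q g"
  unfolding iterated_def nn_integral_cmult[OF nn_integral_fst_borel[OF assms], symmetric]
  by (intro nn_integral_cong nn_integral_cmult)
    (simp add: borel_section_fst[OF assms(1,3)] space_probs[OF assms(2)])

lemma iterated_add:
  assumes "P \<in> \<P>" "Q \<in> \<P>"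
    and "f \<in> borel_measurable (induced_square M F)" "g \<in> borel_measurable (induced_square M F)"
  shows "iterated P Q (\<lambda>z. f z + g z) = iterated P Q f + iterated P Q g"
  unfolding iterated_def
    nn_integral_add[OF nn_integral_fst_borel[OF assms(1,2,3)] nn_integral_fst_borel[OF assms(1,2,4)],
      symmetric]
  by (intro nn_integral_cong nn_integral_add)
    (simp_all add: borel_section_fst[OF assms(1,3)] borel_section_fst[OF assms(1,4)]
      space_probs[OF assms(2)])

text \<open>Monotone convergence is used twice: inside for a fixed second coordinate, then outside
  for the partial integrals, which increase with \<open>i\<close>.\<close>

lemma iterated_SUP:
  assumes "P \<in> \<P>" "Q \<in> \<P>" "\<And>i. U i \<in> borel_measurable (induced_square M F)" "incseq U"
  shows "iterated P Q (SUP i. U i) = (SUP i. iterated P Q (U i))"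
proof -
  have "iterated P Q (SUP i. U i) = (\<integral>\<^sup>+ \<omega>\<^sub>2. (SUP i. \<integral>\<^sup>+ \<omega>\<^sub>1. U i (\<omega>\<^sub>1, \<omega>\<^sub>2) \<partial>P) \<partial>Q)"
    unfolding iterated_def
    by (rule nn_integral_cong)
      (simp only: nn_integral_SUP_section[OF assms(1,3,4)] space_probs[OF assms(2)])
  also have "\<dots> = (SUP i. iterated P Q (U i))"
    unfolding iterated_def
  proof (rule nn_integral_monotone_convergence_SUP)
    show "incseq (\<lambda>i \<omega>\<^sub>2. \<integral>\<^sup>+ \<omega>\<^sub>1. U i (\<omega>\<^sub>1, \<omega>\<^sub>2) \<partial>P)"
      using assms(4) by (auto simp: mono_def le_fun_def intro!: nn_integral_mono)
  qed (rule nn_integral_fst_borel[OF assms(1-3)])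
  finally show ?thesis .
qed

text \<open>Both sides are additive, positively homogeneous and continuous along increasing
  sequences in \<open>g\<close>, so agreement on indicators suffices, and there it is the Fubini
  property.\<close>

lemma iterated_swap:
  assumes fubini: "fubini_property M F \<P>" and PQ: "P \<in> \<P>" "Q \<in> \<P>"
    and "g \<in> borel_measurable (induced_square M F)"
  shows "iterated P Q g = iterated Q P (\<lambda>(\<omega>\<^sub>2, \<omega>\<^sub>1). g (\<omega>\<^sub>1, \<omega>\<^sub>2))"
  using assms(4)
proof (induction g rule: borel_measurable_induct)
  case (cong f g)
  have "iterated P Q f = iterated P Q g"
    using cong.hyps(3) by (rule iterated_cong[OF PQ])
  moreover have "iterated Q P (\<lambda>(\<omega>\<^sub>2, \<omega>\<^sub>1). f (\<omega>\<^sub>1, \<omega>\<^sub>2)) = iterated Q P (\<lambda>(\<omega>\<^sub>2, \<omega>\<^sub>1). g (\<omega>\<^sub>1, \<omega>\<^sub>2))"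
    using cong.hyps(3) by (intro iterated_cong[OF PQ(2,1)]) (auto simp: space_square)
  ultimately show ?case using cong.IH by simp
next
  case (set A)
  \<comment> \<open>The swapped indicator is the indicator of the transposed set. That
    \<open>?A\<close> belongs to the induced sigma-algebra has to be known before
    \<open>iterated_indicator\<close> can be applied to it.\<close>
  let ?A = "{(\<omega>\<^sub>2, \<omega>\<^sub>1). (\<omega>\<^sub>1, \<omega>\<^sub>2) \<in> A}"
  have swap: "(\<lambda>(\<omega>\<^sub>2, \<omega>\<^sub>1). indicator A (\<omega>\<^sub>1, \<omega>\<^sub>2) :: ennreal) = indicator ?A"
    by (auto simp: fun_eq_iff indicator_def)
  have "(indicator ?A :: _ \<Rightarrow> ennreal) \<in> borel_measurable (induced_square M F)"
    unfolding swap[symmetric] by (rule measurable_square_swap[OF borel_measurable_indicator[OF set]])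
  moreover have "?A \<subseteq> space (induced_square M F)"
    using sets.sets_into_space[OF set] by (auto simp: space_square)
  ultimately have A: "?A \<in> sets (induced_square M F)"
    by (simp add: borel_measurable_indicator_iff Int_absorb2)
  have "(\<integral>\<^sup>+ \<omega>\<^sub>2. emeasure P {\<omega>\<^sub>1. (\<omega>\<^sub>1, \<omega>\<^sub>2) \<in> A} \<partial>Q) =
      (\<integral>\<^sup>+ \<omega>\<^sub>1. emeasure Q {\<omega>\<^sub>2. (\<omega>\<^sub>1, \<omega>\<^sub>2) \<in> A} \<partial>P)"
    using fubini PQ set unfolding fubini_property_def by metis
  then show ?case
    unfolding swap iterated_indicator[OF PQ set] iterated_indicator[OF PQ(2,1) A] by simp
next
  case (mult u c)
  then show ?case
    using iterated_cmult[OF PQ mult.hyps(2)]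
      iterated_cmult[OF PQ(2,1) measurable_square_swap[OF mult.hyps(2)]]
    by (simp add: case_prod_unfold)
next
  case (add u v)
  then show ?case
    using iterated_add[OF PQ add.hyps(3,1)]
      iterated_add[OF PQ(2,1) measurable_square_swap[OF add.hyps(3)]
        measurable_square_swap[OF add.hyps(1)]]
    by (simp add: case_prod_unfold)
next
  case (seq U)
  let ?V = "\<lambda>i (\<omega>\<^sub>2, \<omega>\<^sub>1). U i (\<omega>\<^sub>1, \<omega>\<^sub>2)"
  have V: "incseq ?V"
    using seq.hyps(3) by (auto simp: mono_def le_fun_def)
  \<comment> \<open>Suprema of functions are pointwise, so they commute with swapping the
    arguments.\<close>
  have "(\<lambda>(\<omega>\<^sub>2, \<omega>\<^sub>1). (SUP i. U i) (\<omega>\<^sub>1, \<omega>\<^sub>2)) = (SUP i. ?V i)"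
    by (simp add: fun_eq_iff image_comp)
  moreover have "iterated P Q (SUP i. U i) = (SUP i. iterated Q P (?V i))"
    unfolding iterated_SUP[OF PQ seq.hyps(1,3)] seq.IH ..
  moreover have "iterated Q P (SUP i. ?V i) = (SUP i. iterated Q P (?V i))"
    by (rule iterated_SUP[OF PQ(2,1) measurable_square_swap[OF seq.hyps(1)] V])
  ultimately show ?case by (simp only:)
qed

section \<open>Transfer to push-forward measures\<close>

lemma pushforward_nn_integral:
  assumes "quasi_measurable_space M F \<X>" "P \<in> \<P>" "X \<in> qvars \<X>" "f \<in> borel_measurable (induced M \<X>)"
  shows "(\<integral>\<^sup>+ x. f x \<partial>distr P (induced M \<X>) X) = (\<integral>\<^sup>+ \<omega>. f (X \<omega>) \<partial>P)"
proof (rule nn_integral_distr)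
  show "X \<in> measurable P (induced M \<X>)"
    using assms(1,3)
    by (intro measurable_probs[OF assms(2)] qvars_measurable) (auto simp: quasi_measurable_space_def)
qed (use assms(4) in simp)

text \<open>Along a pair \<open>\<Phi>\<close>, \<open>\<Psi>\<close> from \<open>F\<close> the
  pullback becomes \<open>h\<close> along \<open>X\<close> after \<open>\<Phi>\<close> and
  \<open>Y\<close> after \<open>\<Psi>\<close>. These are again admissible, so the measurability of
  \<open>h\<close> applies.\<close>

lemma pullback_measurable:
  assumes \<X>: "quasi_measurable_space M F \<X>" and \<Y>: "quasi_measurable_space M F \<Y>"
    and X: "X \<in> qvars \<X>" and Y: "Y \<in> qvars \<Y>"
    and h: "h \<in> borel_measurable (induced M (qprod M \<X> \<Y>))"
  shows "(\<lambda>(\<omega>\<^sub>1, \<omega>\<^sub>2). h (X \<omega>\<^sub>1, Y \<omega>\<^sub>2)) \<in> borel_measurable (induced_square M F)"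
proof -
  have sub: "qvars \<X> \<subseteq> space M \<rightarrow> qcarrier \<X>" "qvars \<Y> \<subseteq> space M \<rightarrow> qcarrier \<Y>"
    using \<X> \<Y> by (auto simp: quasi_measurable_space_def)
  have "(\<lambda>\<omega>. h (X (\<Phi> \<omega>), Y (\<Psi> \<omega>))) \<in> borel_measurable M" if "\<Phi> \<in> F" "\<Psi> \<in> F" for \<Phi> \<Psi>
  proof -
    have "compose (space M) X \<Phi> \<in> qvars \<X>" "compose (space M) Y \<Psi> \<in> qvars \<Y>"
      using \<X> \<Y> X Y that by (auto simp: quasi_measurable_space_def)
    then have "(\<lambda>\<omega>. h (compose (space M) X \<Phi> \<omega>, compose (space M) Y \<Psi> \<omega>)) \<in> borel_measurable M"
      using h unfolding measurable_induced_qprod_iff[OF sub] by blast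
    then show ?thesis
      by (rule measurable_cong[THEN iffD1, rotated]) (simp add: compose_def)
  qed
  then show ?thesis
    by (simp add: measurable_induced_qprod_iff[OF F_subset F_subset])
qed

text \<open>This is a change of variables in each integral. The outer one requires the inner
  integral to be measurable in \<open>y\<close> for the induced sigma-algebra, which is the main
  point of the proof.\<close>

lemma pushforward_iterated:
  assumes \<X>: "quasi_measurable_space M F \<X>" and \<Y>: "quasi_measurable_space M F \<Y>"
    and P: "P \<in> \<P>" and Q: "Q \<in> \<P>" and X: "X \<in> qvars \<X>" and Y: "Y \<in> qvars \<Y>"
    and h: "h \<in> borel_measurable (induced M (qprod M \<X> \<Y>))"
  shows "(\<integral>\<^sup>+ y. \<integral>\<^sup>+ x. h (x, y) \<partial>distr P (induced M \<X>) X \<partial>distr Q (induced M \<Y>) Y) =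
    iterated P Q (\<lambda>(\<omega>\<^sub>1, \<omega>\<^sub>2). h (X \<omega>\<^sub>1, Y \<omega>\<^sub>2))"
proof -
  have sub: "qvars \<X> \<subseteq> space M \<rightarrow> qcarrier \<X>" "qvars \<Y> \<subseteq> space M \<rightarrow> qcarrier \<Y>"
    using \<X> \<Y> by (auto simp: quasi_measurable_space_def)
  have h_section: "(\<lambda>x. h (x, y)) \<in> borel_measurable (induced M \<X>)" if y: "y \<in> qcarrier \<Y>" for y
  proof -
    have "(\<lambda>\<omega>. h (X' \<omega>, y)) \<in> borel_measurable M" if "X' \<in> qvars \<X>" for X'
    proof -
      \<comment> \<open>Fixing \<open>y\<close> is pairing \<open>X'\<close> with a constant map,
        which is an admissible variable of \<open>\<Y>\<close>.\<close>
      have "(\<lambda>\<omega>\<in>space M. y) \<in> qvars \<Y>"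
        using \<Y> y by (auto simp: quasi_measurable_space_def)
      then have "(\<lambda>\<omega>. h (X' \<omega>, (\<lambda>\<omega>\<in>space M. y) \<omega>)) \<in> borel_measurable M"
        using h that unfolding measurable_induced_qprod_iff[OF sub] by blast
      then show ?thesis
        by (rule measurable_cong[THEN iffD1, rotated]) simp
    qed
    then show ?thesis by (simp add: measurable_induced_iff[OF sub(1)])
  qed
  let ?\<mu> = "distr P (induced M \<X>) X"
  have inner: "(\<integral>\<^sup>+ x. h (x, y) \<partial>?\<mu>) = (\<integral>\<^sup>+ \<omega>\<^sub>1. h (X \<omega>\<^sub>1, y) \<partial>P)" if "y \<in> qcarrier \<Y>" for y
    by (rule pushforward_nn_integral[OF \<X> P X h_section[OF that]])
  have inner_var: "(\<integral>\<^sup>+ x. h (x, Y' \<omega>\<^sub>2) \<partial>?\<mu>) = (\<integral>\<^sup>+ \<omega>\<^sub>1. h (X \<omega>\<^sub>1, Y' \<omega>\<^sub>2) \<partial>P)"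
    if "Y' \<in> qvars \<Y>" "\<omega>\<^sub>2 \<in> space M" for Y' \<omega>\<^sub>2
    using sub(2) that by (intro inner) auto
  \<comment> \<open>The induced sigma-algebra is tested along every admissible \<open>Y'\<close>,
    not only the given \<open>Y\<close>. Along \<open>Y'\<close> the inner integral is the partial
    integral of the pullback of \<open>h\<close> by \<open>X\<close> and \<open>Y'\<close>.\<close>
  have "(\<lambda>\<omega>\<^sub>2. \<integral>\<^sup>+ x. h (x, Y' \<omega>\<^sub>2) \<partial>?\<mu>) \<in> borel_measurable M" if Y': "Y' \<in> qvars \<Y>" for Y'
    using nn_integral_fst_measurable[OF P pullback_measurable[OF \<X> \<Y> X Y' h]]
    by (rule measurable_cong[THEN iffD2, rotated]) (simp add: inner_var[OF Y'])
  then have "(\<lambda>y. \<integral>\<^sup>+ x. h (x, y) \<partial>?\<mu>) \<in> borel_measurable (induced M \<Y>)"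
    by (simp add: measurable_induced_iff[OF sub(2)])
  then have "(\<integral>\<^sup>+ y. \<integral>\<^sup>+ x. h (x, y) \<partial>?\<mu> \<partial>distr Q (induced M \<Y>) Y) =
      (\<integral>\<^sup>+ \<omega>\<^sub>2. \<integral>\<^sup>+ x. h (x, Y \<omega>\<^sub>2) \<partial>?\<mu> \<partial>Q)"
    by (rule pushforward_nn_integral[OF \<Y> Q Y])
  also have "\<dots> = iterated P Q (\<lambda>(\<omega>\<^sub>1, \<omega>\<^sub>2). h (X \<omega>\<^sub>1, Y \<omega>\<^sub>2))"
    unfolding iterated_def
    by (rule nn_integral_cong) (simp add: inner_var[OF Y] space_probs[OF Q])
  finally show ?thesis .
qed

end

theorem theorem5p12:
  fixes M :: "'w measure" and F :: "('w \<Rightarrow> 'w) set" and \<P> :: "'w measure set"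
    and \<X> :: "('w, 'x) qspace" and \<Y> :: "('w, 'y) qspace"
    and \<mu> :: "'x measure" and \<nu> :: "'y measure"
    and h :: "'x \<times> 'y \<Rightarrow> ennreal"
  assumes "product_compatible M F \<P>"
    and "fubini_property M F \<P>"
    and "quasi_measurable_space M F \<X>"
    and "quasi_measurable_space M F \<Y>"
    and "\<mu> \<in> pushforwards M \<P> \<X>"
    and "\<nu> \<in> pushforwards M \<P> \<Y>"
    and "quasi_measurable_map M (qprod M \<X> \<Y>) (qennreal M) h"
  shows "(\<integral>\<^sup>+ y. (\<integral>\<^sup>+ x. h (x, y) \<partial>\<mu>) \<partial>\<nu>) = (\<integral>\<^sup>+ x. (\<integral>\<^sup>+ y. h (x, y) \<partial>\<nu>) \<partial>\<mu>)"
proof -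
  interpret product_compatible M F \<P> by fact
  have sub: "qvars \<X> \<subseteq> space M \<rightarrow> qcarrier \<X>" "qvars \<Y> \<subseteq> space M \<rightarrow> qcarrier \<Y>"
    using assms(3,4) by (auto simp: quasi_measurable_space_def)
  have h: "h \<in> borel_measurable (induced M (qprod M \<X> \<Y>))"
    by (rule quasi_measurable_map_borel[OF qvars_qprod[OF sub] assms(7)])
  obtain P X where P: "P \<in> \<P>" "X \<in> qvars \<X>" "\<mu> = distr P (induced M \<X>) X"
    using assms(5) by (auto simp: pushforwards_def)
  obtain Q Y where Q: "Q \<in> \<P>" "Y \<in> qvars \<Y>" "\<nu> = distr Q (induced M \<Y>) Y"
    using assms(6) by (auto simp: pushforwards_def)
  have "(\<integral>\<^sup>+ y. (\<integral>\<^sup>+ x. h (x, y) \<partial>\<mu>) \<partial>\<nu>) = iterated P Q (\<lambda>(\<omega>\<^sub>1, \<omega>\<^sub>2). h (X \<omega>\<^sub>1, Y \<omega>\<^sub>2))"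
    unfolding P(3) Q(3) by (rule pushforward_iterated[OF assms(3,4) P(1) Q(1) P(2) Q(2) h])
  \<comment> \<open>The Fubini property enters here, on the square of the sample space.\<close>
  also have "\<dots> = iterated Q P (\<lambda>(\<omega>\<^sub>2, \<omega>\<^sub>1). h (X \<omega>\<^sub>1, Y \<omega>\<^sub>2))"
    using iterated_swap[OF assms(2) P(1) Q(1) pullback_measurable[OF assms(3,4) P(2) Q(2) h]]
    by simp
  \<comment> \<open>The other order is the same transfer with the two spaces exchanged, applied to
    \<open>h\<close> with swapped arguments.\<close>
  also have "\<dots> = (\<integral>\<^sup>+ x. (\<integral>\<^sup>+ y. h (x, y) \<partial>\<nu>) \<partial>\<mu>)"
    using pushforward_iterated[OF assms(4,3) Q(1) P(1) Q(2) P(2) measurable_induced_swap[OF sub h]]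
    unfolding P(3) Q(3) by simp
  finally show ?thesis .
qed

end
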